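(* Let $k\ge 2$ be an integer and $G$ a connected graph with at least $k$ vertices. (1) If $D$ is a connected $k$-dominating set of $G$, then $rx_k(G)\leq rx_k(G[D])+k$; consequently $rx_k(G)\leq \gamma_k^c(G)+k-1$. (2) If $G$ has minimum degree at least $k$ and $D$ is a connected $(k-1)$-dominating set of $G$, then $rx_k(G)\leq rx_k(G[D])+k+1$; consequently $rx_k(G)\leq \gamma_{k-1}^c(G)+k$.
   Context: All graphs are simple, finite and undirected. For $D\subseteq V(G)$, $G[D]$ is the subgraph induced by $D$ and $\overline{D}=V(G)\setminus D$. For a positive integer $j$, a set $D\subseteq V(G)$ is a $j$-dominating set if every vertex of $\overline{D}$ is adjacent to at least $j$ distinct vertices of $D$; it is a connected $j$-dominating set if moreover $G[D]$ is connected. The connected $j$-domination number $\gamma_j^c(G)$ is the minimum cardinality of a connected $j$-dominating set of $G$. For an edge-coloring of a connected graph $H$ (adjacent edges may receive the same color), a tree in $H$ is a rainbow tree if no two of its edges receive the same color. For an integer $k$ with $2\leq k\leq |V(H)|$, an edge-coloring is a $k$-rainbow coloring if for every set $S$ of $k$ vertices of $H$ there is a rainbow tree in $H$ containing all vertices of $S$; the $k$-rainbow index $rx_k(H)$ is the minimum number of colors in a $k$-rainbow coloring of $H$. *)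

theory Defs
  imports Main
begin

text \<open>
  A finite simple undirected graph is given by its vertex set \<open>V\<close> and its edge set \<open>E\<close>, whose
  members are the two-element sets of adjacent vertices.
\<close>

definition finite_simple_graph :: "'a set \<Rightarrow> 'a set set \<Rightarrow> bool" where
  "finite_simple_graph V E \<longleftrightarrow>
     finite V \<and> (\<forall>e\<in>E. \<exists>u\<in>V. \<exists>v\<in>V. u \<noteq> v \<and> e = {u, v})"

definition neighbours :: "'a set set \<Rightarrow> 'a \<Rightarrow> 'a set" where
  "neighbours E v = {u. {u, v} \<in> E}"

definition degree :: "'a set set \<Rightarrow> 'a \<Rightarrow> nat" where
  "degree E v = card (neighbours E v)"

text \<open>Only meaningful for finite nonempty \<open>V\<close>.\<close>

definition min_degree :: "'a set \<Rightarrow> 'a set set \<Rightarrow> nat" where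
  "min_degree V E = Min (degree E ` V)"

definition connected_graph :: "'a set \<Rightarrow> 'a set set \<Rightarrow> bool" where
  "connected_graph V E \<longleftrightarrow>
     V \<noteq> {} \<and> (\<forall>u\<in>V. \<forall>v\<in>V. (u, v) \<in> {(x, y). {x, y} \<in> E}\<^sup>*)"

text \<open>The graph induced by \<open>D\<close> has vertex set \<open>D\<close> and edge set \<open>induced_edges E D\<close>.\<close>

definition induced_edges :: "'a set set \<Rightarrow> 'a set \<Rightarrow> 'a set set" where
  "induced_edges E D = {e \<in> E. e \<subseteq> D}"

text \<open>A cycle is the list of its vertices; the last one is adjacent to the first one.\<close>

definition is_cycle :: "'a set set \<Rightarrow> 'a list \<Rightarrow> bool" where
  "is_cycle E vs \<longleftrightarrow>
     3 \<le> length vs \<and> distinct vs \<and>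
     (\<forall>i < length vs. {vs ! i, vs ! (Suc i mod length vs)} \<in> E)"

definition is_tree :: "'a set \<Rightarrow> 'a set set \<Rightarrow> bool" where
  "is_tree T F \<longleftrightarrow>
     finite_simple_graph T F \<and> connected_graph T F \<and> (\<nexists>vs. is_cycle F vs)"

definition dominating :: "nat \<Rightarrow> 'a set \<Rightarrow> 'a set set \<Rightarrow> 'a set \<Rightarrow> bool" where
  "dominating j V E D \<longleftrightarrow>
     D \<subseteq> V \<and> (\<forall>v \<in> V - D. j \<le> card (neighbours E v \<inter> D))"

definition connected_dominating :: "nat \<Rightarrow> 'a set \<Rightarrow> 'a set set \<Rightarrow> 'a set \<Rightarrow> bool" where
  "connected_dominating j V E D \<longleftrightarrow>
     dominating j V E D \<and> connected_graph D (induced_edges E D)"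

text \<open>The minimum exists for connected graphs, since \<open>V\<close> itself is a connected dominating set.\<close>

definition connected_domination_number :: "nat \<Rightarrow> 'a set \<Rightarrow> 'a set set \<Rightarrow> nat" where
  "connected_domination_number j V E =
     (LEAST n. \<exists>D. connected_dominating j V E D \<and> card D = n)"

definition rainbow_tree ::
    "'a set \<Rightarrow> 'a set set \<Rightarrow> ('a set \<Rightarrow> nat) \<Rightarrow> 'a set \<Rightarrow> 'a set set \<Rightarrow> bool" where
  "rainbow_tree V E c T F \<longleftrightarrow>
     T \<subseteq> V \<and> F \<subseteq> E \<and> is_tree T F \<and> inj_on c F"

definition rainbow_coloring ::
    "nat \<Rightarrow> 'a set \<Rightarrow> 'a set set \<Rightarrow> ('a set \<Rightarrow> nat) \<Rightarrow> bool" where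
  "rainbow_coloring k V E c \<longleftrightarrow>
     (\<forall>S. S \<subseteq> V \<and> card S = k \<longrightarrow> (\<exists>T F. rainbow_tree V E c T F \<and> S \<subseteq> T))"

text \<open>
  The number of colors of \<open>c\<close> is the number of colors occurring on edges. The \<open>k\<close>-rainbow index is
  only meaningful for finite connected graphs and \<open>2 \<le> k \<le> card V\<close>. In that range the minimum
  exists, since an edge coloring with pairwise distinct colors is a \<open>k\<close>-rainbow coloring.
\<close>

definition rainbow_index :: "nat \<Rightarrow> 'a set \<Rightarrow> 'a set set \<Rightarrow> nat" where
  "rainbow_index k V E =
     (LEAST n. \<exists>c. rainbow_coloring k V E c \<and> card (c ` E) = n)"

end

theory Submission
  imports Defs
begin

text \<open>
  Keep an optimal coloring of \<open>G[D]\<close> and give every vertex outside \<open>D\<close> differently colored edges to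
  \<open>D\<close>, using fresh colors. If the vertices of \<open>S\<close> outside \<open>D\<close> can choose distinct colors, they are
  attached as leaves to a rainbow tree of \<open>G[D]\<close>. With \<open>k\<close> neighbours in \<open>D\<close> the fresh colors
  \<open>1, \<dots>, k\<close> suffice. With only \<open>k - 1\<close> of them, let \<open>P\<close> be a maximal independent set of the vertices
  outside \<open>D\<close> with fewer than \<open>k\<close> neighbours in \<open>D\<close>. Vertices of \<open>P\<close> use \<open>1, \<dots>, k - 1\<close>, the others
  use \<open>2, \<dots>, k\<close>, or all of \<open>1, \<dots>, k\<close> if they have enough neighbours, and edges outside \<open>D\<close> get the
  color \<open>0\<close>. The choice fails only if \<open>S\<close> lies in \<open>P\<close>, or avoids \<open>P \<union> D\<close> and contains no vertex with
  \<open>k\<close> neighbours in \<open>D\<close>. Then one vertex of \<open>S\<close> has a neighbour of the other kind and reaches \<open>D\<close>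
  through it, along an edge of color \<open>0\<close>.
\<close>

section \<open>Finite simple graphs and their induced subgraphs\<close>

lemma finite_edges:
  assumes "finite_simple_graph V E"
  shows "finite E"
proof -
  have "E \<subseteq> Pow V" using assms unfolding finite_simple_graph_def by fastforce
  then show ?thesis using assms finite_subset unfolding finite_simple_graph_def by blast
qed

lemma edge_ends:
  assumes "finite_simple_graph V E" "{u, v} \<in> E"
  shows "u \<in> V" "v \<in> V" "u \<noteq> v"
proof -
  obtain a b where "a \<in> V" "b \<in> V" "a \<noteq> b" "{u, v} = {a, b}"
    using assms unfolding finite_simple_graph_def by metis
  then show "u \<in> V" "v \<in> V" "u \<noteq> v" by (auto simp: doubleton_eq_iff)
qed

lemma finite_neighbours:
  assumes "finite_simple_graph V E"
  shows "finite (neighbours E v)"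
proof -
  have "neighbours E v \<subseteq> V" using edge_ends[OF assms] unfolding neighbours_def by blast
  then show ?thesis using assms finite_subset unfolding finite_simple_graph_def by blast
qed

lemma finite_simple_graph_induced:
  assumes "finite_simple_graph V E" "D \<subseteq> V"
  shows "finite_simple_graph D (induced_edges E D)"
  unfolding finite_simple_graph_def
proof (intro conjI ballI)
  show "finite D" using assms finite_subset unfolding finite_simple_graph_def by blast
next
  fix e assume "e \<in> induced_edges E D"
  then have e: "e \<in> E" "e \<subseteq> D" by (auto simp: induced_edges_def)
  then obtain u v where "u \<noteq> v" "e = {u, v}" using assms unfolding finite_simple_graph_def by blast
  then show "\<exists>u\<in>D. \<exists>v\<in>D. u \<noteq> v \<and> e = {u, v}" using e by blast
qed

lemma induced_edges_whole:
  assumes "finite_simple_graph V E"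
  shows "induced_edges E V = E"
proof -
  have "\<forall>e\<in>E. e \<subseteq> V" using assms unfolding finite_simple_graph_def by fastforce
  then show ?thesis unfolding induced_edges_def by blast
qed

section \<open>Adding leaves to trees and rainbow trees\<close>

text \<open>A cycle through \<open>v\<close> would enter and leave it along its only edge
  \<open>{u, v}\<close>, so both cycle neighbours of \<open>v\<close> would be \<open>u\<close>,
  which is impossible with at least three distinct vertices.\<close>

lemma acyclic_add_leaf:
  assumes F: "\<forall>e\<in>F. e \<subseteq> T" and v: "v \<notin> T" and u: "u \<in> T" and nc: "\<nexists>vs. is_cycle F vs"
  shows "\<nexists>vs. is_cycle (insert {u, v} F) vs"
proof
  assume "\<exists>vs. is_cycle (insert {u, v} F) vs"
  then obtain vs where cyc: "is_cycle (insert {u, v} F) vs" by blast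
  define n where "n = length vs"
  have n: "3 \<le> n" and dis: "distinct vs"
    and ed: "\<And>i. i < n \<Longrightarrow> {vs ! i, vs ! (Suc i mod n)} \<in> insert {u, v} F"
    using cyc unfolding is_cycle_def n_def by auto
  have uv: "u \<noteq> v" using u v by blast
  show False
  proof (cases "v \<in> set vs")
    case True
    then obtain i where i: "i < n" "vs ! i = v" unfolding n_def by (metis in_set_conv_nth)
    have "{vs ! i, vs ! (Suc i mod n)} = {u, v}" using ed[OF i(1)] i(2) F v by blast
    then have s: "vs ! (Suc i mod n) = u" using i(2) uv by (auto simp: doubleton_eq_iff)
    \<comment> \<open>The cyclic predecessor of \<open>i\<close>; it is about to coincide with the
      successor.\<close>
    define j where "j = (if i = 0 then n - 1 else i - 1)"
    have j: "j < n" "Suc j mod n = i" using i(1) n by (cases "i = 0"; simp add: j_def)+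
    have "{vs ! j, vs ! i} = {u, v}" using ed[OF j(1)] j(2) i(2) F v by auto
    then have "vs ! j = u" using i(2) uv by (auto simp: doubleton_eq_iff)
    then have "j = Suc i mod n" using s dis j(1) n unfolding n_def
      by (metis nth_eq_iff_index_eq mod_less_divisor less_le_trans zero_less_numeral)
    then show False using n i(1) 
      by (cases "i = 0"; cases "Suc i = n"; simp add: j_def)
  next
    case False
    have "{vs ! i, vs ! (Suc i mod n)} \<in> F" if "i < n" for i
    proof -
      have "Suc i mod n < n" using n by simp
      then have "vs ! i \<noteq> v" "vs ! (Suc i mod n) \<noteq> v"
        using False that unfolding n_def by (metis nth_mem)+
      then show ?thesis using ed[OF that] by (auto simp: doubleton_eq_iff)
    qed
    then have "is_cycle F vs" using n dis unfolding is_cycle_def n_def by blast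
    then show False using nc by blast
  qed
qed

lemma is_tree_add_leaf:
  assumes t: "is_tree T F" and v: "v \<notin> T" and u: "u \<in> T"
  shows "is_tree (insert v T) (insert {u, v} F)"
proof -
  have g: "finite_simple_graph T F" and c: "connected_graph T F" and nc: "\<nexists>vs. is_cycle F vs"
    using t unfolding is_tree_def by auto
  have F: "\<forall>e\<in>F. e \<subseteq> T" using g unfolding finite_simple_graph_def by fastforce
  have uv: "u \<noteq> v" using u v by blast
  have g': "finite_simple_graph (insert v T) (insert {u, v} F)"
    using g u uv unfolding finite_simple_graph_def by blast
  let ?R = "{(x, y). {x, y} \<in> F}" and ?R' = "{(x, y). {x, y} \<in> insert {u, v} F}"
  have mono: "?R\<^sup>* \<subseteq> ?R'\<^sup>*" by (rule rtrancl_mono) auto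
  have uvR: "(u, v) \<in> ?R'\<^sup>*" "(v, u) \<in> ?R'\<^sup>*" by (auto simp: insert_commute)
  have old: "(x, y) \<in> ?R'\<^sup>*" if "x \<in> T" "y \<in> T" for x y
    using c that mono unfolding connected_graph_def by blast
  have "(x, y) \<in> ?R'\<^sup>*" if "x \<in> insert v T" "y \<in> insert v T" for x y
  proof -
    have "(x, u) \<in> ?R'\<^sup>*" using that(1) old u uvR by blast
    moreover have "(u, y) \<in> ?R'\<^sup>*" using that(2) old u uvR by blast
    ultimately show ?thesis by (rule rtrancl_trans)
  qed
  then have "connected_graph (insert v T) (insert {u, v} F)" unfolding connected_graph_def by blast
  then show ?thesis using g' acyclic_add_leaf[OF F v u nc] unfolding is_tree_def by blast
qed

lemma rainbow_tree_add_leaf: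
  assumes "rainbow_tree V E c T F" "v \<in> V" "v \<notin> T" "u \<in> T" "{u, v} \<in> E" "c {u, v} \<notin> c ` F"
  shows "rainbow_tree V E c (insert v T) (insert {u, v} F)"
proof -
  have t: "T \<subseteq> V" "F \<subseteq> E" "is_tree T F" "inj_on c F"
    using assms(1) unfolding rainbow_tree_def by auto
  have "inj_on c (insert {u, v} F)" using t(4) assms(6) by (simp add: inj_on_insert) blast
  then show ?thesis
    using t is_tree_add_leaf[OF t(3) assms(3,4)] assms(2,5) unfolding rainbow_tree_def by blast
qed

text \<open>All leaves hang on the original \<open>T\<close>, never on one another, so it is enough
  that the new colors avoid those of \<open>F\<close> and differ among themselves.\<close>

lemma rainbow_tree_add_leaves:
  assumes "rainbow_tree V E c T F" "finite W" "W \<subseteq> V - T"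
    and "\<And>w. w \<in> W \<Longrightarrow> g w \<in> T \<and> {g w, w} \<in> E \<and> c {g w, w} \<notin> c ` F"
    and "inj_on (\<lambda>w. c {g w, w}) W"
  shows "rainbow_tree V E c (T \<union> W) (F \<union> (\<lambda>w. {g w, w}) ` W)"
  using assms(2-)
proof (induction W rule: finite_induct)
  case empty
  then show ?case using assms(1) by simp
next
  case (insert w W)
  have "rainbow_tree V E c (T \<union> W) (F \<union> (\<lambda>w. {g w, w}) ` W)"
    using insert by (intro insert.IH) auto
  moreover have "c {g w, w} \<notin> c ` (F \<union> (\<lambda>w. {g w, w}) ` W)"
  proof
    assume "c {g w, w} \<in> c ` (F \<union> (\<lambda>w. {g w, w}) ` W)"
    then obtain w' where "w' \<in> W" "c {g w, w} = c {g w', w'}" using insert.prems(2)[of w] by auto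
    then show False using insert.prems(3) insert.hyps(2) unfolding inj_on_def by blast
  qed
  ultimately have "rainbow_tree V E c (insert w (T \<union> W)) (insert {g w, w} (F \<union> (\<lambda>w. {g w, w}) ` W))"
    using insert by (intro rainbow_tree_add_leaf) auto
  then show ?case by simp
qed

section \<open>Spanning trees\<close>

text \<open>A subtree grows by one vertex and one edge at a time. The edge count is what later
  bounds the number of colors.\<close>

lemma spanning_tree_exists:
  assumes g: "finite_simple_graph V E" and c: "connected_graph V E"
  obtains F where "F \<subseteq> E" "is_tree V F" "Suc (card F) = card V"
proof -
  have fV: "finite V" and ne: "V \<noteq> {}"
    using g c unfolding finite_simple_graph_def connected_graph_def by auto
  have "\<exists>T F. T \<subseteq> V \<and> F \<subseteq> E \<and> is_tree T F \<and> card T = Suc n \<and> card F = n" if "Suc n \<le> card V" for n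
    using that
  proof (induction n)
    case 0
    obtain r where r: "r \<in> V" using ne by blast
    have "is_tree {r} {}"
      by (simp add: is_tree_def finite_simple_graph_def connected_graph_def is_cycle_def)
        (metis list.size(3) not_numeral_le_zero length_greater_0_conv)
    then show ?case using r by (intro exI[of _ "{r}"] exI[of _ "{}"]) auto
  next
    case (Suc n)
    then obtain T F where TF: "T \<subseteq> V" "F \<subseteq> E" "is_tree T F" "card T = Suc n" "card F = n"
      by auto
    obtain r where r: "r \<in> T" using TF(4) by fastforce
    obtain s where s: "s \<in> V" "s \<notin> T" using Suc.prems TF(1,4) by (metis Suc_n_not_le_n subsetI subset_antisym)
    \<comment> \<open>If no edge left \<open>T\<close>, everything reachable from \<open>r\<close>
      would stay in \<open>T\<close>, including \<open>s\<close>.\<close>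
    have "\<exists>u v. u \<in> T \<and> v \<notin> T \<and> {u, v} \<in> E"
    proof (rule ccontr)
      assume no: "\<not> ?thesis"
      have "(r, s) \<in> {(x, y). {x, y} \<in> E}\<^sup>*" using c r s TF(1) unfolding connected_graph_def by blast
      then have "s \<in> T" using r no by (induction rule: rtrancl_induct) auto
      then show False using s by blast
    qed
    then obtain u v where uv: "u \<in> T" "v \<notin> T" "{u, v} \<in> E" by blast
    have "v \<in> V" using edge_ends[OF g uv(3)] by blast
    have "{u, v} \<notin> F" using TF(3) uv edge_ends unfolding is_tree_def by metis
    moreover have "finite F" using TF(3) finite_edges unfolding is_tree_def by blast
    moreover have "finite T" using TF(1) fV finite_subset by blast
    ultimately show ?case
      using is_tree_add_leaf[OF TF(3) uv(2,1)] TF uv \<open>v \<in> V\<close>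
      by (intro exI[of _ "insert v T"] exI[of _ "insert {u, v} F"]) auto
  qed
  moreover have "card V = Suc (card V - 1)" using fV ne by (metis Suc_pred' card_gt_0_iff)
  ultimately obtain T F where TF: "T \<subseteq> V" "F \<subseteq> E" "is_tree T F" "card T = card V" "card F = card V - 1"
    by (metis order_refl)
  then have "T = V" using fV by (simp add: card_subset_eq)
  then show thesis using that TF \<open>card V = Suc (card V - 1)\<close> by auto
qed

section \<open>Colorings covering small vertex sets, and attainment of the minima\<close>

text \<open>
  Unlike a \<open>k\<close>-rainbow coloring, this is meaningful for \<open>card V < k\<close> too, which is needed in part (2)
  when a minimum connected dominating set has only \<open>k - 1\<close> vertices.
\<close>

definition covering_coloring :: "nat \<Rightarrow> 'a set \<Rightarrow> 'a set set \<Rightarrow> ('a set \<Rightarrow> nat) \<Rightarrow> bool" where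
  "covering_coloring k V E c \<longleftrightarrow>
     (\<forall>S. S \<subseteq> V \<and> card S \<le> k \<longrightarrow> (\<exists>T F. rainbow_tree V E c T F \<and> S \<subseteq> T))"

text \<open>A smaller set is first enlarged to exactly \<open>k\<close> vertices, for which
  \<open>V\<close> must be large enough.\<close>

lemma rainbow_coloring_imp_covering:
  assumes "rainbow_coloring k V E c" "finite V" "k \<le> card V"
  shows "covering_coloring k V E c"
  unfolding covering_coloring_def
proof (intro allI impI)
  fix S assume S: "S \<subseteq> V \<and> card S \<le> k"
  then obtain S' where S': "S \<subseteq> S'" "S' \<subseteq> V" "card S' = k"
    using exists_subset_between[of S k V] assms by blast
  have "\<exists>T F. rainbow_tree V E c T F \<and> S' \<subseteq> T"
    using assms(1) S'(2,3) unfolding rainbow_coloring_def by simp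
  then show "\<exists>T F. rainbow_tree V E c T F \<and> S \<subseteq> T" using S'(1) by (meson order_trans)
qed

text \<open>One rainbow spanning tree serves every \<open>S\<close> at once. This is the source of
  the bounds by the connected domination numbers.\<close>

lemma spanning_tree_coloring:
  assumes g: "finite_simple_graph V E" and c: "connected_graph V E"
  obtains c where "covering_coloring k V E c" "card (c ` E) \<le> card V - 1"
proof -
  obtain F where F: "F \<subseteq> E" "is_tree V F" "Suc (card F) = card V"
    using spanning_tree_exists[OF g c] .
  have fin: "finite F" using F(1) finite_edges[OF g] finite_subset by blast
  obtain h :: "'a set \<Rightarrow> nat" where h: "inj_on h F" using fin finite_imp_inj_to_nat_seg by metis
  \<comment> \<open>Edges outside the tree repeat a tree color, so that they add nothing to the
    count.\<close>
  define col where "col e = (if e \<in> F then h e else h (SOME f. f \<in> F))" for e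
  have "inj_on col F" using h unfolding inj_on_def col_def by auto
  then have "rainbow_tree V E col V F" using F unfolding rainbow_tree_def by blast
  then have cov: "covering_coloring k V E col" unfolding covering_coloring_def by blast
  have "card (col ` E) \<le> card F"
  proof (cases "F = {}")
    case True
    \<comment> \<open>Without tree edges the default color is arbitrary, but then there is a single
      vertex and no edge to color.\<close>
    then have "card V = 1" using F(3) by simp
    then have "E = {}" using g unfolding finite_simple_graph_def
      by (metis card_1_singletonE equals0I singletonD)
    then show ?thesis by simp
  next
    case False
    then have "(SOME f. f \<in> F) \<in> F" by (simp add: some_in_eq)
    then have "col ` E \<subseteq> h ` F" unfolding col_def by auto
    then show ?thesis using fin by (meson card_image_le card_mono finite_imageI order_trans)
  qed
  then show thesis using that cov F(3) by simp
qed

lemma rainbow_index_le: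
  assumes "rainbow_coloring k V E c"
  shows "rainbow_index k V E \<le> card (c ` E)"
  unfolding rainbow_index_def by (rule Least_le) (use assms in blast)

lemma rainbow_index_attained:
  assumes "finite_simple_graph V E" "connected_graph V E"
  obtains c where "rainbow_coloring k V E c" "card (c ` E) = rainbow_index k V E"
proof -
  obtain c where "covering_coloring k V E c" using spanning_tree_coloring[OF assms] by blast
  then have "rainbow_coloring k V E c" unfolding covering_coloring_def rainbow_coloring_def by simp
  then have "\<exists>n c. rainbow_coloring k V E c \<and> card (c ` E) = n" by blast
  from LeastI_ex[OF this] show thesis using that unfolding rainbow_index_def by blast
qed

lemma connected_domination_number_attained:
  assumes "finite_simple_graph V E" "connected_graph V E"
  obtains D where "connected_dominating j V E D" "card D = connected_domination_number j V E"
proof -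
  have "connected_dominating j V E V"
    using assms induced_edges_whole[OF assms(1)] unfolding connected_dominating_def dominating_def by simp
  then have "\<exists>n D. connected_dominating j V E D \<and> card D = n" by blast
  from LeastI_ex[OF this] show thesis using that unfolding connected_domination_number_def by blast
qed

section \<open>Fresh colors outside \<open>D\<close> and the attachment of outer vertices\<close>

text \<open>\<open>I v\<close> is the palette of the outer vertex \<open>v\<close>,
  \<open>f v i\<close> the end in \<open>D\<close> of its edge of color \<open>i\<close>,
  \<open>B\<close> the stock of fresh colors, and \<open>z\<close> the default for the other edges
  not inside \<open>D\<close>.\<close>

lemma extend_coloring:
  fixes c :: "'a set \<Rightarrow> nat" and f :: "'a \<Rightarrow> nat \<Rightarrow> 'a"
  assumes fin: "finite E" "finite B" and z: "z \<in> B"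
    and fV: "\<forall>v\<in>V - D. I v \<subseteq> B \<and> inj_on (f v) (I v) \<and> f v ` I v \<subseteq> D"
  obtains c' where
    "\<And>T F. rainbow_tree D (induced_edges E D) c T F \<Longrightarrow> rainbow_tree D (induced_edges E D) c' T F"
    "\<And>e. e \<subseteq> D \<Longrightarrow> c' e \<notin> B"
    "\<And>v i. v \<in> V - D \<Longrightarrow> i \<in> I v \<Longrightarrow> c' {f v i, v} = i"
    "\<And>e. e \<noteq> {} \<Longrightarrow> e \<inter> D = {} \<Longrightarrow> c' e = z"
    "card (c' ` E) \<le> card (c ` induced_edges E D) + card B"
proof -
  have f: "I v \<subseteq> B \<and> inj_on (f v) (I v) \<and> f v ` I v \<subseteq> D" if "v \<in> V - D" for v
    using fV that by blast
  \<comment> \<open>Shifting \<open>c\<close> by \<open>N\<close> makes the colors in \<open>B\<close> fresh.\<close>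
  define N where "N = Suc (Max B)"
  have N: "b < N" if "b \<in> B" for b using that fin(2) unfolding N_def by (simp add: less_Suc_eq_le)
  let ?P = "\<lambda>e i. \<exists>v. v \<in> V - D \<and> i \<in> I v \<and> e = {f v i, v}"
  define c' where "c' e = (if e \<subseteq> D then c e + N else if \<exists>i. ?P e i then SOME i. ?P e i else z)" for e
  have in_D: "c' e = c e + N" if "e \<subseteq> D" for e using that unfolding c'_def by simp
  have special: "c' {f v i, v} = i" if vi: "v \<in> V - D" "i \<in> I v" for v i
  proof -
    \<comment> \<open>The choice by \<open>SOME\<close> is unambiguous: the edge determines its
      outer end, and then its end in \<open>D\<close> determines the color by injectivity of
      \<open>f v\<close>.\<close>
    have "j = i" if "?P {f v i, v} j" for j
    proof -
      obtain w where w: "w \<in> V - D" "j \<in> I w" "{f v i, v} = {f w j, w}" using \<open>?P _ j\<close> by blast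
      have "f v i \<in> D" "f w j \<in> D" using f vi w by blast+
      then have "v = w" "f v i = f w j" using w vi by (auto simp: doubleton_eq_iff)
      then show ?thesis using f[OF vi(1)] vi w by (metis inj_onD)
    qed
    moreover have "?P {f v i, v} i" using vi by blast
    ultimately have "(SOME j. ?P {f v i, v} j) = i" by (intro some_equality)
    moreover have "\<not> {f v i, v} \<subseteq> D" using vi by simp
    moreover have "\<exists>j. ?P {f v i, v} j" using vi by blast
    ultimately show ?thesis unfolding c'_def by (simp only: if_True if_False)
  qed
  have rest: "c' e = z" if "e \<noteq> {}" "e \<inter> D = {}" for e
  proof -
    have "\<not> (\<exists>i. ?P e i)" using f that by blast
    then show ?thesis using that unfolding c'_def by auto
  qed
  have old: "c' e \<notin> B" if "e \<subseteq> D" for e using N in_D[OF that] by fastforce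
  have tree: "rainbow_tree D (induced_edges E D) c' T F"
    if t: "rainbow_tree D (induced_edges E D) c T F" for T F
  proof -
    have "\<forall>e\<in>F. e \<subseteq> D" using t unfolding rainbow_tree_def induced_edges_def by blast
    then have "inj_on c' F" using t in_D unfolding rainbow_tree_def inj_on_def by auto
    then show ?thesis using t unfolding rainbow_tree_def by blast
  qed
  have "card (c' ` E) \<le> card (c ` induced_edges E D) + card B"
  proof -
    have "c' e \<in> (\<lambda>n. n + N) ` c ` induced_edges E D \<union> B" if "e \<in> E" for e
    proof (cases "e \<subseteq> D")
      case True
      then show ?thesis using that in_D unfolding induced_edges_def by blast
    next
      case False
      have "(SOME i. ?P e i) \<in> B" if "\<exists>i. ?P e i"
        using someI_ex[OF that] f by blast
      then have "c' e \<in> B" using False z unfolding c'_def by auto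
      then show ?thesis by blast
    qed
    then have sub: "c' ` E \<subseteq> (\<lambda>n. n + N) ` c ` induced_edges E D \<union> B" by blast
    have fc: "finite (c ` induced_edges E D)" using fin(1) unfolding induced_edges_def by simp
    have "card (c' ` E) \<le> card ((\<lambda>n. n + N) ` c ` induced_edges E D \<union> B)"
      using sub fc fin(2) by (intro card_mono) auto
    also have "\<dots> \<le> card ((\<lambda>n. n + N) ` c ` induced_edges E D) + card B" by (rule card_Un_le)
    also have "\<dots> \<le> card (c ` induced_edges E D) + card B" using card_image_le[OF fc] by simp
    finally show ?thesis .
  qed
  with tree old special rest show thesis by (rule that)
qed

text \<open>Replacing each \<open>w\<close> by its attachment point \<open>h w\<close> gives at most
  \<open>k\<close> vertices of \<open>D\<close>, which a rainbow tree inside \<open>D\<close>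
  covers; the vertices of \<open>W\<close> then become leaves. The last two conclusions leave room
  for one more leaf with a color not yet used.\<close>

lemma attach_outside:
  assumes g: "finite_simple_graph V E" and DV: "D \<subseteq> V"
    and cov: "covering_coloring k D (induced_edges E D) c"
    and S: "S \<subseteq> D" and W: "W \<subseteq> V - D" and card: "card S + card W \<le> k"
    and hW: "\<forall>w\<in>W. h w \<in> D \<and> {h w, w} \<in> E \<and> c {h w, w} \<in> B"
    and inj: "inj_on (\<lambda>w. c {h w, w}) W"
    and disjD: "\<forall>e\<subseteq>D. c e \<notin> B"
  obtains T F where "rainbow_tree V E c T F" "S \<union> W \<subseteq> T" "T \<subseteq> D \<union> W"
    "\<And>e. e \<in> F \<Longrightarrow> e \<subseteq> D \<or> c e \<in> B"
proof -
  have h: "h w \<in> D \<and> {h w, w} \<in> E \<and> c {h w, w} \<in> B" if "w \<in> W" for w using hW that by blast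
  have disj: "c e \<notin> B" if "e \<subseteq> D" for e using disjD that by blast
  have finW: "finite W" using g W finite_subset unfolding finite_simple_graph_def by blast
  have "card (S \<union> h ` W) \<le> k"
    using card card_Un_le[of S "h ` W"] card_image_le[OF finW, of h] by linarith
  then obtain T F where TF: "rainbow_tree D (induced_edges E D) c T F" "S \<union> h ` W \<subseteq> T"
    using cov S h unfolding covering_coloring_def by (metis Un_subset_iff image_subsetI)
  have T: "T \<subseteq> D" and F: "\<And>e. e \<in> F \<Longrightarrow> e \<subseteq> D"
    using TF(1) unfolding rainbow_tree_def induced_edges_def by auto
  have "rainbow_tree V E c T F"
    using TF(1) DV unfolding rainbow_tree_def induced_edges_def by blast
  then have "rainbow_tree V E c (T \<union> W) (F \<union> (\<lambda>w. {h w, w}) ` W)"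
  proof (rule rainbow_tree_add_leaves)
    fix w assume w: "w \<in> W"
    have "c {h w, w} \<notin> c ` F"
    proof
      assume "c {h w, w} \<in> c ` F"
      then obtain e where "e \<in> F" "c e = c {h w, w}" by force
      then show False using h[OF w] disj[OF F] by metis
    qed
    then show "h w \<in> T \<and> {h w, w} \<in> E \<and> c {h w, w} \<notin> c ` F"
      using h[OF w] TF(2) w by blast
  qed (use finW W T inj in auto)
  then show thesis
  proof (rule that)
    show "e \<subseteq> D \<or> c e \<in> B" if "e \<in> F \<union> (\<lambda>w. {h w, w}) ` W" for e using that F h by blast
  qed (use TF(2) T in auto)
qed

section \<open>The bound for \<open>k\<close>-dominating sets\<close>

text \<open>Leaving \<open>c\<close> arbitrary lets it be either an optimal coloring of the induced
  graph or a spanning tree coloring.\<close>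

lemma rainbow_index_le_k_dominating:
  assumes g: "finite_simple_graph V E" and k: "1 \<le> k"
    and dom: "dominating k V E D" and cov: "covering_coloring k D (induced_edges E D) c"
  shows "rainbow_index k V E \<le> card (c ` induced_edges E D) + k"
proof -
  have DV: "D \<subseteq> V" using dom unfolding dominating_def by blast
  have "\<exists>f. inj_on f {1..k} \<and> f ` {1..k} \<subseteq> neighbours E v \<inter> D" if "v \<in> V - D" for v
    using card_le_inj[of "{1..k}" "neighbours E v \<inter> D"] finite_neighbours[OF g] dom that
    unfolding dominating_def by auto
  then obtain f where f: "\<And>v. v \<in> V - D \<Longrightarrow> inj_on (f v) {1..k} \<and> f v ` {1..k} \<subseteq> neighbours E v \<inter> D"
    by metis
  have fD: "\<forall>v\<in>V - D. {1..k} \<subseteq> {1..k} \<and> inj_on (f v) {1..k} \<and> f v ` {1..k} \<subseteq> D"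
    using f by simp
  \<comment> \<open>The trees below use no edge with both ends outside \<open>D\<close>, so the
    default can be one of the \<open>k\<close> colors and costs nothing extra.\<close>
  have B: "finite {1..k}" "1 \<in> {1..k}" using k by simp_all
  obtain c' where c':
    "\<And>T F. rainbow_tree D (induced_edges E D) c T F \<Longrightarrow> rainbow_tree D (induced_edges E D) c' T F"
    "\<And>e. e \<subseteq> D \<Longrightarrow> c' e \<notin> {1..k}"
    "\<And>v i. v \<in> V - D \<Longrightarrow> i \<in> {1..k} \<Longrightarrow> c' {f v i, v} = i"
    "\<And>e. e \<noteq> {} \<Longrightarrow> e \<inter> D = {} \<Longrightarrow> c' e = 1"
    "card (c' ` E) \<le> card (c ` induced_edges E D) + card {1..k}"
    by (rule extend_coloring[OF finite_edges[OF g] B fD, where c = c]) (rule that)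
  have cov': "covering_coloring k D (induced_edges E D) c'"
    using cov c'(1) unfolding covering_coloring_def by meson
  have "rainbow_coloring k V E c'"
    unfolding rainbow_coloring_def
  proof (intro allI impI)
    fix S assume S: "S \<subseteq> V \<and> card S = k"
    then have finS: "finite S" using k card.infinite by fastforce
    have cS: "card (S \<inter> D) + card (S - D) = k"
      using S finS card_Int_Diff by metis
    then have "card (S - D) \<le> card {1..k}" by simp
    then obtain a where a: "inj_on a (S - D)" "a ` (S - D) \<subseteq> {1..k}"
      using card_le_inj[of "S - D" "{1..k}"] finS by auto
    have SD: "S - D \<subseteq> V - D" using S by blast
    have eq: "c' {f w (a w), w} = a w" if "w \<in> S - D" for w using that SD a c'(3) by blast
    have inj: "inj_on (\<lambda>w. c' {f w (a w), w}) (S - D)" using a(1) eq unfolding inj_on_def by auto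
    have att: "\<forall>w\<in>S - D. f w (a w) \<in> D \<and> {f w (a w), w} \<in> E \<and> c' {f w (a w), w} \<in> {1..k}"
    proof
      fix w assume w: "w \<in> S - D"
      have "f w (a w) \<in> neighbours E w \<inter> D" using f[of w] a(2) w SD by blast
      then show "f w (a w) \<in> D \<and> {f w (a w), w} \<in> E \<and> c' {f w (a w), w} \<in> {1..k}"
        using eq w a(2) unfolding neighbours_def by auto
    qed
    have disj: "\<forall>e\<subseteq>D. c' e \<notin> {1..k}" using c'(2) by simp
    obtain T F where "rainbow_tree V E c' T F" "(S \<inter> D) \<union> (S - D) \<subseteq> T"
      by (rule attach_outside[OF g DV cov' Int_lower2 SD eq_imp_le[OF cS] att inj disj]) (rule that)
    then show "\<exists>T F. rainbow_tree V E c' T F \<and> S \<subseteq> T" by blast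
  qed
  then show ?thesis using rainbow_index_le c'(5) by fastforce
qed

section \<open>The bound for \<open>(k - 1)\<close>-dominating sets\<close>

text \<open>Each range has only \<open>k - 1\<close> colors, hence the strict bounds; they keep
  \<open>A\<close> off the color \<open>k\<close> and \<open>W - A\<close> off the color
  \<open>1\<close>.\<close>

lemma inj_into_overlapping_ranges:
  fixes k :: nat
  assumes "finite W" "card W \<le> k" "A \<subseteq> W" "card A < k" "card (W - A) < k"
  obtains a where "inj_on a W" "\<And>w. w \<in> A \<Longrightarrow> a w \<in> {1..<k}" "\<And>w. w \<in> W - A \<Longrightarrow> a w \<in> {2..k}"
proof -
  \<comment> \<open>\<open>A\<close> takes the lowest colors and \<open>W - A\<close> the highest ones.\<close>
  let ?p = "card A" and ?q = "card (W - A)"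
  have fin: "finite A" "finite (W - A)" using assms finite_subset by auto
  have pq: "?p + ?q \<le> k"
    using assms fin by (metis Diff_partition card_Un_disjoint Diff_disjoint)
  obtain a where a: "inj_on a A" "a ` A \<subseteq> {1..?p}" using card_le_inj[OF fin(1), of "{1..?p}"] by auto
  obtain b where b: "inj_on b (W - A)" "b ` (W - A) \<subseteq> {Suc (k - ?q)..k}"
    using card_le_inj[OF fin(2), of "{Suc (k - ?q)..k}"] assms by auto
  have ba: "a w \<in> {1..?p}" if "w \<in> A" for w using a that by blast
  have bb: "b w \<in> {Suc (k - ?q)..k}" if "w \<in> W - A" for w using b that by blast
  define h where "h w = (if w \<in> A then a w else b w)" for w
  have cross: "a x \<noteq> b y" if "x \<in> A" "y \<in> W - A" for x y
    using ba[OF that(1)] bb[OF that(2)] pq by auto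
  have "inj_on h W"
  proof (rule inj_onI)
    fix x y assume xy: "x \<in> W" "y \<in> W" "h x = h y"
    consider "x \<in> A" "y \<in> A" | "x \<in> A" "y \<in> W - A" | "x \<in> W - A" "y \<in> A" | "x \<in> W - A" "y \<in> W - A"
      using xy by blast
    then show "x = y"
    proof cases
      case 1
      then show ?thesis using xy(3) a(1) by (simp add: h_def inj_on_def)
    next
      case 2
      then show ?thesis using xy(3) cross by (auto simp: h_def)
    next
      case 3
      then show ?thesis using xy(3) cross[of y x] by (auto simp: h_def)
    next
      case 4
      then show ?thesis using xy(3) b(1) by (auto simp: h_def inj_on_def)
    qed
  qed
  moreover have "h w \<in> {1..<k}" if "w \<in> A" for w
    using ba[OF that] assms(4) that by (auto simp: h_def)
  moreover have "h w \<in> {2..k}" if "w \<in> W - A" for w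
    using bb[OF that] assms(5) that by (auto simp: h_def)
  ultimately show thesis using that by blast
qed

text \<open>In an inclusion-maximal independent subset of \<open>N\<close>, a vertex of
  \<open>N - P\<close> without a neighbour in \<open>P\<close> could be added.\<close>

lemma maximal_independent_set:
  assumes "finite N" "\<And>v. {v, v} \<notin> E"
  obtains P where "P \<subseteq> N" "\<And>u v. u \<in> P \<Longrightarrow> v \<in> P \<Longrightarrow> {u, v} \<notin> E"
    "\<And>v. v \<in> N - P \<Longrightarrow> \<exists>u\<in>P. {u, v} \<in> E"
proof -
  define I where "I = {P. P \<subseteq> N \<and> (\<forall>u\<in>P. \<forall>v\<in>P. {u, v} \<notin> E)}"
  have "finite I" using assms(1) unfolding I_def by simp
  moreover have "{} \<in> I" unfolding I_def by simp
  ultimately have "\<exists>P\<in>I. \<forall>Q\<in>I. P \<subseteq> Q \<longrightarrow> P = Q"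
    using finite_has_maximal[of I] by blast
  then obtain P where PI: "P \<in> I" and mx: "\<forall>Q\<in>I. P \<subseteq> Q \<longrightarrow> P = Q" by blast
  have P: "P \<subseteq> N" "\<And>u v. u \<in> P \<Longrightarrow> v \<in> P \<Longrightarrow> {u, v} \<notin> E" using PI unfolding I_def by auto
  have "\<exists>u\<in>P. {u, v} \<in> E" if v: "v \<in> N - P" for v
  proof (rule ccontr)
    assume no: "\<not> ?thesis"
    have "{v, u} \<notin> E" if "u \<in> P" for u using no that by (metis insert_commute)
    then have "insert v P \<in> I" using P v no assms(2) unfolding I_def by auto
    then show False using mx v by blast
  qed
  then show thesis using that P by blast
qed

lemma rainbow_index_le_pred_k_dominating:
  assumes g: "finite_simple_graph V E" and k: "2 \<le> k" and deg: "\<And>v. v \<in> V \<Longrightarrow> k \<le> degree E v"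
    and dom: "dominating (k - 1) V E D" and cov: "covering_coloring k D (induced_edges E D) c"
  shows "rainbow_index k V E \<le> card (c ` induced_edges E D) + k + 1"
proof -
  have DV: "D \<subseteq> V" using dom unfolding dominating_def by blast
  have finV: "finite V" using g unfolding finite_simple_graph_def by blast
  let ?nb = "\<lambda>v. neighbours E v \<inter> D"
  \<comment> \<open>By domination these have exactly \<open>k - 1\<close> neighbours in
    \<open>D\<close>, just enough for a palette of size \<open>k - 1\<close>.\<close>
  define N where "N = {v \<in> V - D. card (?nb v) < k}"
  have "{v, v} \<notin> E" for v using edge_ends(3)[OF g, of v v] by blast
  moreover have "finite N" using finV unfolding N_def by simp
  ultimately obtain P where PN: "P \<subseteq> N"
    and ind: "\<And>u v. u \<in> P \<Longrightarrow> v \<in> P \<Longrightarrow> {u, v} \<notin> E"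
    and mx: "\<And>v. v \<in> N - P \<Longrightarrow> \<exists>u\<in>P. {u, v} \<in> E"
    using maximal_independent_set by metis
  have PD: "P \<subseteq> V - D" using PN unfolding N_def by blast
  define I where "I v = (if v \<in> P then {1..<k} else if v \<in> N then {2..k} else {1..k})" for v
  have "\<exists>f. inj_on f (I v) \<and> f ` I v \<subseteq> ?nb v" if v: "v \<in> V - D" for v
  proof -
    have "k - 1 \<le> card (?nb v)" using dom v unfolding dominating_def by blast
    then have "card (I v) \<le> card (?nb v)" using v unfolding I_def N_def by auto
    moreover have "finite (I v)" unfolding I_def by simp
    ultimately show ?thesis
      using card_le_inj[of "I v" "?nb v"] finite_neighbours[OF g] by auto
  qed
  then obtain f where f: "\<And>v. v \<in> V - D \<Longrightarrow> inj_on (f v) (I v) \<and> f v ` I v \<subseteq> ?nb v"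
    by metis
  have IB: "I v \<subseteq> {1..k}" for v unfolding I_def by auto
  have fD: "\<forall>v\<in>V - D. I v \<subseteq> {0..k} \<and> inj_on (f v) (I v) \<and> f v ` I v \<subseteq> D"
    using f IB by (meson Int_subset_iff atLeastatMost_subset_iff order_trans zero_le order_refl)
  \<comment> \<open>Color \<open>0\<close> is reserved for edges with no end in \<open>D\<close>,
    which gives \<open>k + 1\<close> fresh colors.\<close>
  have B: "finite {0..k}" "0 \<in> {0..k}" by simp_all
  obtain c' where c':
    "\<And>T F. rainbow_tree D (induced_edges E D) c T F \<Longrightarrow> rainbow_tree D (induced_edges E D) c' T F"
    "\<And>e. e \<subseteq> D \<Longrightarrow> c' e \<notin> {0..k}"
    "\<And>v i. v \<in> V - D \<Longrightarrow> i \<in> I v \<Longrightarrow> c' {f v i, v} = i"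
    "\<And>e. e \<noteq> {} \<Longrightarrow> e \<inter> D = {} \<Longrightarrow> c' e = 0"
    "card (c' ` E) \<le> card (c ` induced_edges E D) + card {0..k}"
    by (rule extend_coloring[OF finite_edges[OF g] B fD, where c = c]) (rule that)
  have cov': "covering_coloring k D (induced_edges E D) c'"
    using cov c'(1) unfolding covering_coloring_def by meson
  \<comment> \<open>The case without a detour: \<open>A\<close> draws from \<open>{1..<k}\<close>
    and \<open>W - A\<close> from \<open>{2..k}\<close>. Color \<open>0\<close> stays free.\<close>
  have tree: "\<exists>T F. rainbow_tree V E c' T F \<and> S \<union> W \<subseteq> T \<and> T \<subseteq> D \<union> W \<and> 0 \<notin> c' ` F"
    if S: "S \<subseteq> D" and W: "W \<subseteq> V - D" and cSW: "card S + card W \<le> k"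
      and A: "A \<subseteq> W" "card A < k" "card (W - A) < k"
      and AI: "\<And>w. w \<in> A \<Longrightarrow> {1..<k} \<subseteq> I w" "\<And>w. w \<in> W - A \<Longrightarrow> {2..k} \<subseteq> I w" for S W A
  proof -
    have "finite W" using W finV finite_subset by blast
    moreover have "card W \<le> k" using cSW by simp
    ultimately obtain a where a: "inj_on a W" "\<And>w. w \<in> A \<Longrightarrow> a w \<in> {1..<k}"
      "\<And>w. w \<in> W - A \<Longrightarrow> a w \<in> {2..k}"
      using inj_into_overlapping_ranges A by metis
    have aI: "a w \<in> I w" if "w \<in> W" for w using a(2,3)[of w] AI[of w] that by blast
    have eq: "c' {f w (a w), w} = a w" if "w \<in> W" for w using that W aI c'(3) by blast
    have inj: "inj_on (\<lambda>w. c' {f w (a w), w}) W" using a(1) eq unfolding inj_on_def by auto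
    have att: "\<forall>w\<in>W. f w (a w) \<in> D \<and> {f w (a w), w} \<in> E \<and> c' {f w (a w), w} \<in> {1..k}"
    proof
      fix w assume w: "w \<in> W"
      have "f w (a w) \<in> ?nb w" using f[of w] aI w W by blast
      then show "f w (a w) \<in> D \<and> {f w (a w), w} \<in> E \<and> c' {f w (a w), w} \<in> {1..k}"
        using eq[OF w] aI[OF w] IB[of w] unfolding neighbours_def by auto
    qed
    \<comment> \<open>Attaching with \<open>{1..k}\<close> instead of \<open>{0..k}\<close> is what
      excludes color \<open>0\<close> from the tree.\<close>
    have disj: "\<forall>e\<subseteq>D. c' e \<notin> {1..k}" using c'(2) by simp
    obtain T F where TF: "rainbow_tree V E c' T F" "S \<union> W \<subseteq> T" "T \<subseteq> D \<union> W"
      "\<And>e. e \<in> F \<Longrightarrow> e \<subseteq> D \<or> c' e \<in> {1..k}"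
      by (rule attach_outside[OF g DV cov' S W cSW att inj disj]) (rule that)
    have "c' e \<noteq> 0" if "e \<in> F" for e
      using TF(4)[OF that] c'(2)[of e] by auto
    then show ?thesis using TF by force
  qed
  \<comment> \<open>The vertex \<open>y\<close> takes the place of \<open>s\<close> among the
    \<open>k\<close> vertices attached to \<open>D\<close>; then \<open>s\<close> is hung on
    \<open>y\<close> by an edge of color \<open>0\<close>.\<close>
  have detour: "\<exists>T F. rainbow_tree V E c' T F \<and> S \<subseteq> T"
    if S: "S \<subseteq> V - D" "card S = k" and s: "s \<in> S" and y: "y \<in> V - D" "y \<notin> S" "{y, s} \<in> E"
      and A: "A \<subseteq> insert y (S - {s})" "card A < k" "card (insert y (S - {s}) - A) < k"
      and AI: "\<And>w. w \<in> A \<Longrightarrow> {1..<k} \<subseteq> I w" "\<And>w. w \<in> insert y (S - {s}) - A \<Longrightarrow> {2..k} \<subseteq> I w"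
    for S s y A
  proof -
    have "finite S" using S(1) finV finite_subset by blast
    then have "card (insert y (S - {s})) = k" using S s y(2) k by simp
    then have "card ({} :: 'a set) + card (insert y (S - {s})) \<le> k" by simp
    moreover have "insert y (S - {s}) \<subseteq> V - D" using S(1) y(1) by blast
    ultimately obtain T F where TF: "rainbow_tree V E c' T F" "{} \<union> insert y (S - {s}) \<subseteq> T"
      "T \<subseteq> D \<union> insert y (S - {s})" "0 \<notin> c' ` F"
      using tree[OF empty_subsetI _ _ A AI] by blast
    have "c' {y, s} = 0" using S(1) s y(1) by (intro c'(4)) auto
    then have "rainbow_tree V E c' (insert s T) (insert {y, s} F)"
      using TF S s y by (intro rainbow_tree_add_leaf) auto
    then show ?thesis using TF(2) by blast
  qed
  have "rainbow_coloring k V E c'"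
    unfolding rainbow_coloring_def
  proof (intro allI impI)
    fix S assume S: "S \<subseteq> V \<and> card S = k"
    then have finS: "finite S" using k card.infinite by fastforce
    have cS: "card (S \<inter> D) + card (S - D) = k" using S finS card_Int_Diff by metis
    have IP: "{1..<k} \<subseteq> I w" if "w \<in> P" for w using that unfolding I_def by auto
    have IQ: "{2..k} \<subseteq> I w" if "w \<notin> P" for w using that unfolding I_def by auto
    \<comment> \<open>Since \<open>S\<close> has \<open>k\<close> vertices, a class with
      \<open>k\<close> of them is all of \<open>S\<close>.\<close>
    consider (gen) "card (S \<inter> P) < k" "card ((S - D) - P) < k"
      | (inP) "card (S \<inter> P) \<ge> k" | (outP) "card ((S - D) - P) \<ge> k" by linarith
    then show "\<exists>T F. rainbow_tree V E c' T F \<and> S \<subseteq> T"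
    proof cases
      case gen
      have "(S - D) - (S \<inter> P) = (S - D) - P" by blast
      then have "\<exists>T F. rainbow_tree V E c' T F \<and> (S \<inter> D) \<union> (S - D) \<subseteq> T \<and> T \<subseteq> D \<union> (S - D) \<and> 0 \<notin> c' ` F"
        using gen cS S PD IP IQ by (intro tree[where A = "S \<inter> P"]) auto
      then show ?thesis by (metis Int_Diff_Un)
    next
      case inP
      then have SP: "S \<subseteq> P" using S finS by (metis Int_lower1 card_seteq inf.absorb_iff1)
      obtain s where s: "s \<in> S" using S k by fastforce
      have sN: "s \<in> V - D" "card (?nb s) < k" using s SP PN unfolding N_def by auto
      \<comment> \<open>The degree exceeds the number of neighbours in \<open>D\<close>, so some
        neighbour \<open>y\<close> lies outside \<open>D\<close>, and by independence outside
        \<open>P\<close>.\<close>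
      have "card (neighbours E s) \<ge> k" using deg sN unfolding degree_def by blast
      then have "\<not> neighbours E s \<subseteq> D" using sN(2) by (metis inf.absorb1 not_le)
      then obtain y where y: "{y, s} \<in> E" "y \<notin> D" unfolding neighbours_def by blast
      have yP: "y \<notin> P" using ind[of y s] y(1) s SP by blast
      have yS: "y \<notin> S" using yP SP by blast
      \<comment> \<open>The \<open>k - 1\<close> remaining vertices of \<open>S\<close> share
        \<open>{1..<k}\<close>, and \<open>y\<close> alone uses \<open>{2..k}\<close>;
        \<open>2 \<le> k\<close> makes both classes small enough.\<close>
      have "insert y (S - {s}) - (S - {s}) = {y}" using yS by blast
      then show ?thesis
      proof (intro detour[of S s y "S - {s}"])
        show "{1..<k} \<subseteq> I w" if "w \<in> S - {s}" for w using IP that SP by blast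
        show "{2..k} \<subseteq> I w" if "w \<in> insert y (S - {s}) - (S - {s})" for w using IQ that yP by blast
      qed (use S SP PD s y edge_ends[OF g y(1)] yS finS k in auto)
    next
      case outP
      then have "(S - D) - P = S" using S finS by (intro card_seteq) auto
      then have SD: "S \<subseteq> V - D" "S \<inter> P = {}" using S by auto
      obtain s where s: "s \<in> S" using S k by fastforce
      show ?thesis
      \<comment> \<open>One arbitrary \<open>s\<close> decides: every vertex of \<open>S\<close> can
        use \<open>{2..k}\<close>, so it suffices to relieve that range of \<open>s\<close>.\<close>
      proof (cases "s \<in> N")
        case True
        then obtain x where x: "x \<in> P" "{x, s} \<in> E" using mx[of s] s SD by blast
        have xS: "x \<notin> S" using x SD by blast
        \<comment> \<open>Here \<open>x\<close> alone draws from \<open>{1..<k}\<close>.\<close>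
        have "insert x (S - {s}) - {x} = S - {s}" using xS by blast
        then show ?thesis
        proof (intro detour[of S s x "{x}"])
          show "{1..<k} \<subseteq> I w" if "w \<in> {x}" for w using IP that x(1) by blast
          show "{2..k} \<subseteq> I w" if "w \<in> insert x (S - {s}) - {x}" for w using IQ that SD by blast
        qed (use S SD PD s x xS finS k in auto)
      next
        case False
        have "s \<notin> P" using False PN by blast
        then have Is: "{1..<k} \<subseteq> I s" using False unfolding I_def by auto
        have "\<exists>T F. rainbow_tree V E c' T F \<and> {} \<union> S \<subseteq> T \<and> T \<subseteq> D \<union> S \<and> 0 \<notin> c' ` F"
        proof (intro tree[where A = "{s}"])
          show "{1..<k} \<subseteq> I w" if "w \<in> {s}" for w using Is that by blast
          show "{2..k} \<subseteq> I w" if "w \<in> S - {s}" for w using IQ that SD by blast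
        qed (use S SD s finS k in auto)
        then show ?thesis by auto
      qed
    qed
  qed
  then show ?thesis using rainbow_index_le c'(5) by fastforce
qed

section \<open>Rainbow index and connected domination numbers\<close>

text \<open>The condition \<open>k \<le> card D\<close> in part (2) makes the rainbow index of the
  induced graph meaningful, as \<open>D\<close> may have only \<open>k - 1\<close> vertices there;
  in part (1) this size is automatic.\<close>

theorem theorem3p12:
  fixes V :: "'a set" and E :: "'a set set" and k :: nat
  assumes "2 \<le> k"
    and "finite_simple_graph V E"
    and "connected_graph V E"
    and "k \<le> card V"
  shows
    "(\<forall>D. connected_dominating k V E D \<longrightarrow>
        rainbow_index k V E \<le> rainbow_index k D (induced_edges E D) + k) \<and>
     rainbow_index k V E \<le> connected_domination_number k V E + k - 1 \<and>
     (k \<le> min_degree V E \<longrightarrow>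
        (\<forall>D. connected_dominating (k - 1) V E D \<and> k \<le> card D \<longrightarrow>
           rainbow_index k V E \<le> rainbow_index k D (induced_edges E D) + k + 1) \<and>
        rainbow_index k V E \<le> connected_domination_number (k - 1) V E + k)"
proof -
  note k = assms(1) and g = assms(2) and conn = assms(3)
  have finV: "finite V" using g unfolding finite_simple_graph_def by blast
  have D: "finite_simple_graph D (induced_edges E D)" "connected_graph D (induced_edges E D)"
    "dominating j V E D" "finite D" "1 \<le> card D" if "connected_dominating j V E D" for j D
  proof -
    show d: "connected_graph D (induced_edges E D)" "dominating j V E D"
      using that unfolding connected_dominating_def by auto
    then show fs: "finite_simple_graph D (induced_edges E D)"
      using finite_simple_graph_induced[OF g] unfolding dominating_def by blast
    then show "finite D" unfolding finite_simple_graph_def by blast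
    then show "1 \<le> card D" using d(1) unfolding connected_graph_def by (simp add: Suc_le_eq card_gt_0_iff)
  qed
  have optimal: "\<exists>c. covering_coloring k D (induced_edges E D) c \<and>
      card (c ` induced_edges E D) = rainbow_index k D (induced_edges E D)"
    if "connected_dominating j V E D" "k \<le> card D" for j D
    using rainbow_index_attained[OF D(1,2)[OF that(1)], of k] rainbow_coloring_imp_covering
      D(4)[OF that(1)] that(2) by metis
  have tree: "\<exists>c. covering_coloring k D (induced_edges E D) c \<and>
      card (c ` induced_edges E D) \<le> card D - 1"
    if "connected_dominating j V E D" for j D
    using spanning_tree_coloring[OF D(1,2)[OF that], of k] by metis
  have "rainbow_index k V E \<le> rainbow_index k D (induced_edges E D) + k"
    if cd: "connected_dominating k V E D" for D
  proof -
    \<comment> \<open>A vertex outside \<open>D\<close> already has \<open>k\<close> neighbours in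
      \<open>D\<close>.\<close>
    have "k \<le> card D"
    proof (cases "D = V")
      case False
      then obtain v where "v \<in> V - D" using D(3)[OF cd] unfolding dominating_def by blast
      then have "k \<le> card (neighbours E v \<inter> D)" using D(3)[OF cd] unfolding dominating_def by blast
      then show ?thesis using D(4)[OF cd] by (meson Int_lower2 card_mono order_trans)
    qed (use assms(4) in simp)
    then show ?thesis
      using optimal[OF cd] rainbow_index_le_k_dominating[OF g _ D(3)[OF cd]] k by fastforce
  qed
  moreover have "rainbow_index k V E \<le> connected_domination_number k V E + k - 1"
  proof -
    obtain X where X: "connected_dominating k V E X" "card X = connected_domination_number k V E"
      using connected_domination_number_attained[OF g conn] .
    obtain c where "covering_coloring k X (induced_edges E X) c" "card (c ` induced_edges E X) \<le> card X - 1"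
      using tree[OF X(1)] by blast
    then show ?thesis
      using rainbow_index_le_k_dominating[OF g _ D(3)[OF X(1)], of c] k D(5)[OF X(1)] X(2) by linarith
  qed
  moreover have "rainbow_index k V E \<le> rainbow_index k D (induced_edges E D) + k + 1"
    if "k \<le> min_degree V E" "connected_dominating (k - 1) V E D \<and> k \<le> card D" for D
  proof -
    have "k \<le> degree E v" if "v \<in> V" for v
      using \<open>k \<le> min_degree V E\<close> that finV unfolding min_degree_def by (meson Min_le finite_imageI imageI order_trans)
    moreover obtain c where "covering_coloring k D (induced_edges E D) c"
      "card (c ` induced_edges E D) = rainbow_index k D (induced_edges E D)"
      using optimal \<open>_ \<and> _\<close> by blast
    ultimately show ?thesis
      using rainbow_index_le_pred_k_dominating[OF g k _ D(3)] \<open>_ \<and> _\<close> by metis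
  qed
  moreover have "rainbow_index k V E \<le> connected_domination_number (k - 1) V E + k"
    if "k \<le> min_degree V E"
  proof -
    have deg: "k \<le> degree E v" if "v \<in> V" for v
      using \<open>k \<le> min_degree V E\<close> that finV unfolding min_degree_def by (meson Min_le finite_imageI imageI order_trans)
    obtain X where X: "connected_dominating (k - 1) V E X" "card X = connected_domination_number (k - 1) V E"
      using connected_domination_number_attained[OF g conn] .
    obtain c where "covering_coloring k X (induced_edges E X) c" "card (c ` induced_edges E X) \<le> card X - 1"
      using tree[OF X(1)] by blast
    \<comment> \<open>The \<open>card X - 1\<close> tree colors and the \<open>k + 1\<close> fresh
      ones sum to \<open>card X + k\<close>, as \<open>X\<close> is nonempty.\<close>
    then show ?thesis
      using rainbow_index_le_pred_k_dominating[OF g k deg D(3)[OF X(1)], of c] D(5)[OF X(1)] X(2) by linarith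
  qed
  ultimately show ?thesis by blast
qed

end
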